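(* Let $\psi$ be a triangle center function. If $\mathbf X_\psi$ is a semi-invariant curve-generating center with respect to the aliquot triangle family $\mathbf\Phi_A(t)=(0,1-t,t)$, then $\mathbf X_\psi$ is also a semi-invariant curve-generating center with respect to every decomposable triangle family, including the nedian family $\mathbf\Phi_N(t)=((1-t)t,\,t^2,\,(1-t)^2)$.
   Context: **Triangles and centers.** $\triangle$ is the set of non-degenerate triangles $\Delta=(\mathbf A,\mathbf B,\mathbf C)$ in $\mathbb R^2$, with side lengths $a=|\mathbf B\mathbf C|$, $b=|\mathbf C\mathbf A|$, $c=|\mathbf A\mathbf B|$. A triangle center function is a real function $\psi\not\equiv 0$ of $(a,b,c)$ (side lengths of non-degenerate triangles) that is homogeneous of some real degree and satisfies $\psi(a,b,c)=\psi(a,c,b)$. It defines the triangle center $\mathbf X_\psi=\frac{a\psi(a,b,c)\mathbf A+b\psi(b,c,a)\mathbf B+c\psi(c,a,b)\mathbf C}{a\psi(a,b,c)+b\psi(b,c,a)+c\psi(c,a,b)}$ whenever the denominator is nonzero. $\mathbf X_2=\frac13(\mathbf A+\mathbf B+\mathbf C)$ is the centroid. **Triangle families.** A triangle family $\mathbf\Psi=(\Psi_1,\Psi_2,\Psi_3):\mathbb R\to\mathbb R^3$ satisfies $\Psi_1(t)+\Psi_2(t)+\Psi_3(t)\ne0$ for all $t$ and not $\Psi_1\equiv\Psi_2\equiv\Psi_3$. Applied to $\Delta$, it yields triangles $\Delta_t^{\mathbf\Psi}$ with vertices of barycentric coordinates $\mathbf A_t=[\Psi_1:\Psi_2:\Psi_3]$,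 $\mathbf B_t=[\Psi_3:\Psi_1:\Psi_2]$, $\mathbf C_t=[\Psi_2:\Psi_3:\Psi_1]$ (evaluated at $t$) with respect to $\mathbf A,\mathbf B,\mathbf C$. It is decomposable if for all $t\in\mathbb R$, $2\Psi_1(t)-\Psi_2(t)-\Psi_3(t)=0$ implies $\Psi_1(t)=\Psi_2(t)=\Psi_3(t)$. **Triangle curves.** $\mathbf X_\psi^{\mathbf\Psi}(t)$ is the center of $\Delta_t^{\mathbf\Psi}$ determined by $\psi$ (using the side lengths of $\Delta_t^{\mathbf\Psi}$); if $\Psi_1(t)=\Psi_2(t)=\Psi_3(t)$, the triangle degenerates to $\mathbf X_2$ and $\mathbf X_\psi^{\mathbf\Psi}(t)=\mathbf X_2$. Equilateral $\Delta$ are excluded throughout, and curves are considered where the center is defined. All $\Delta_t^{\mathbf\Psi}$ have centroid $\mathbf X_2$, and curves for different $\Delta$ are compared relative to $\mathbf X_2$. **Semi-invariance.** $\mathbf X_\psi$ is a semi-invariant curve-generating center with respect to $\mathbf\Psi$ if the curves $t\mapsto\mathbf X_\psi^{\mathbf\Psi}(t)$ for different $\Delta$ differ only by an affine transformation: there are functions $l_x(t),l_y(t)$ independent of $\Delta$ and, for each $\Delta$, vectors $\mathbf V_x,\mathbf V_y\in\mathbb R^2$ with $\mathbf X_\psi^{\mathbf\Psi}(t)=\mathbf X_2+l_x(t)\mathbf V_x+l_y(t)\mathbf V_y$ for all $t$. *)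

theory Defs
  imports "HOL-Analysis.Analysis"
begin

type_synonym point = "real^2"
type_synonym triangle = "point \<times> point \<times> point"

text \<open>Since \<open>collinear\<close> holds for every set of at most two points, the vertices of a
  nondegenerate triangle are automatically distinct.\<close>

fun nondegenerate :: "triangle \<Rightarrow> bool" where
  "nondegenerate (A, B, C) \<longleftrightarrow> \<not> collinear {A, B, C}"

fun equilateral :: "triangle \<Rightarrow> bool" where
  "equilateral (A, B, C) \<longleftrightarrow> dist B C = dist C A \<and> dist C A = dist A B"

fun centroid :: "triangle \<Rightarrow> point" where
  "centroid (A, B, C) = (1/3) *\<^sub>R (A + B + C)"

fun bary :: "real \<times> real \<times> real \<Rightarrow> triangle \<Rightarrow> point" where
  "bary (u, v, w) (A, B, C) = (1 / (u + v + w)) *\<^sub>R (u *\<^sub>R A + v *\<^sub>R B + w *\<^sub>R C)"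

fun side_lengths :: "triangle \<Rightarrow> real \<times> real \<times> real" where
  "side_lengths (A, B, C) = (dist B C, dist C A, dist A B)"

text \<open>A function of the side lengths is a total function whose values outside the set
  \<open>side_triples\<close> play no role.\<close>

definition side_triples :: "(real \<times> real \<times> real) set" where
  "side_triples = side_lengths ` {\<Delta>. nondegenerate \<Delta>}"

definition triangle_center_function :: "(real \<Rightarrow> real \<Rightarrow> real \<Rightarrow> real) \<Rightarrow> bool" where
  "triangle_center_function \<psi> \<longleftrightarrow>
     (\<exists>(a, b, c) \<in> side_triples. \<psi> a b c \<noteq> 0) \<and>
     (\<exists>d::real. \<forall>(a, b, c) \<in> side_triples. \<forall>s>0.
        \<psi> (s * a) (s * b) (s * c) = s powr d * \<psi> a b c) \<and>
     (\<forall>(a, b, c) \<in> side_triples. \<psi> a b c = \<psi> a c b)"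

definition center_weights ::
    "(real \<Rightarrow> real \<Rightarrow> real \<Rightarrow> real) \<Rightarrow> triangle \<Rightarrow> real \<times> real \<times> real" where
  "center_weights \<psi> \<Delta> =
     (case side_lengths \<Delta> of (a, b, c) \<Rightarrow> (a * \<psi> a b c, b * \<psi> b c a, c * \<psi> c a b))"

definition center_defined :: "(real \<Rightarrow> real \<Rightarrow> real \<Rightarrow> real) \<Rightarrow> triangle \<Rightarrow> bool" where
  "center_defined \<psi> \<Delta> \<longleftrightarrow> (case center_weights \<psi> \<Delta> of (u, v, w) \<Rightarrow> u + v + w \<noteq> 0)"

definition triangle_center :: "(real \<Rightarrow> real \<Rightarrow> real \<Rightarrow> real) \<Rightarrow> triangle \<Rightarrow> point" where
  "triangle_center \<psi> \<Delta> = bary (center_weights \<psi> \<Delta>) \<Delta>"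

definition triangle_family :: "(real \<Rightarrow> real^3) \<Rightarrow> bool" where
  "triangle_family \<Psi> \<longleftrightarrow>
     (\<forall>t. \<Psi> t $ 1 + \<Psi> t $ 2 + \<Psi> t $ 3 \<noteq> 0) \<and>
     \<not> (\<forall>t. \<Psi> t $ 1 = \<Psi> t $ 2 \<and> \<Psi> t $ 2 = \<Psi> t $ 3)"

definition family_triangle :: "(real \<Rightarrow> real^3) \<Rightarrow> triangle \<Rightarrow> real \<Rightarrow> triangle" where
  "family_triangle \<Psi> \<Delta> t =
     (bary (\<Psi> t $ 1, \<Psi> t $ 2, \<Psi> t $ 3) \<Delta>,
      bary (\<Psi> t $ 3, \<Psi> t $ 1, \<Psi> t $ 2) \<Delta>,
      bary (\<Psi> t $ 2, \<Psi> t $ 3, \<Psi> t $ 1) \<Delta>)"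

definition decomposable :: "(real \<Rightarrow> real^3) \<Rightarrow> bool" where
  "decomposable \<Psi> \<longleftrightarrow>
     (\<forall>t. 2 * \<Psi> t $ 1 - \<Psi> t $ 2 - \<Psi> t $ 3 = 0 \<longrightarrow>
          \<Psi> t $ 1 = \<Psi> t $ 2 \<and> \<Psi> t $ 2 = \<Psi> t $ 3)"

definition aliquot_family :: "real \<Rightarrow> real^3" where
  "aliquot_family t = vector [0, 1 - t, t]"

definition nedian_family :: "real \<Rightarrow> real^3" where
  "nedian_family t = vector [(1 - t) * t, t\<^sup>2, (1 - t)\<^sup>2]"

definition curve ::
    "(real \<Rightarrow> real \<Rightarrow> real \<Rightarrow> real) \<Rightarrow> (real \<Rightarrow> real^3) \<Rightarrow> triangle \<Rightarrow> real \<Rightarrow> point" where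
  "curve \<psi> \<Psi> \<Delta> t =
     (if \<Psi> t $ 1 = \<Psi> t $ 2 \<and> \<Psi> t $ 2 = \<Psi> t $ 3 then centroid \<Delta>
      else triangle_center \<psi> (family_triangle \<Psi> \<Delta> t))"

definition curve_defined ::
    "(real \<Rightarrow> real \<Rightarrow> real \<Rightarrow> real) \<Rightarrow> (real \<Rightarrow> real^3) \<Rightarrow> triangle \<Rightarrow> real \<Rightarrow> bool" where
  "curve_defined \<psi> \<Psi> \<Delta> t \<longleftrightarrow>
     (\<Psi> t $ 1 = \<Psi> t $ 2 \<and> \<Psi> t $ 2 = \<Psi> t $ 3) \<or> center_defined \<psi> (family_triangle \<Psi> \<Delta> t)"

text \<open>The coefficient functions \<open>lx\<close>, \<open>ly\<close> are chosen before the triangle. For each triangle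
  the equation is required exactly at the parameters where the center exists.\<close>

definition semi_invariant ::
    "(real \<Rightarrow> real \<Rightarrow> real \<Rightarrow> real) \<Rightarrow> (real \<Rightarrow> real^3) \<Rightarrow> bool" where
  "semi_invariant \<psi> \<Psi> \<longleftrightarrow>
     (\<exists>lx ly :: real \<Rightarrow> real. \<forall>\<Delta>. nondegenerate \<Delta> \<and> \<not> equilateral \<Delta> \<longrightarrow>
        (\<exists>Vx Vy :: point. \<forall>t. curve_defined \<psi> \<Psi> \<Delta> t \<longrightarrow>
           curve \<psi> \<Psi> \<Delta> t = centroid \<Delta> + lx t *\<^sub>R Vx + ly t *\<^sub>R Vy))"

end

theory Submission
  imports Defs
begin

text \<open>A decomposable family produces nothing but rescaled aliquot triangles. Fix \<open>t\<close> and write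
  \<open>p\<close>, \<open>q\<close>, \<open>r\<close> for the coordinates of \<open>\<Psi> t\<close>, with sum \<open>S\<close>. Subtracting the centroid from the
  first vertex leaves the coefficients \<open>p / S - 1/3\<close>, \<open>q / S - 1/3\<close>, \<open>r / S - 1/3\<close>, which add up
  to zero; for the aliquot family at \<open>\<tau>\<close> they are \<open>- 1/3\<close>, \<open>2/3 - \<tau>\<close>, \<open>\<tau> - 1/3\<close>. As \<open>\<tau>\<close> varies, these
  vectors fill an affine line that misses the origin of the plane of zero-sum vectors. Every vector
  of that plane is therefore a real multiple of one on the line, except for the nonzero vectors
  parallel to it. These have first coefficient zero, that is \<open>2 p = q + r\<close>, and decomposability
  excludes them. Solving for the multiple gives \<open>s = (q + r - 2 p) / S\<close> and
  \<open>\<tau> = (r - p) / (q + r - 2 p)\<close>, both independent of the triangle, and cyclic symmetry gives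
  the same relation for the other two vertices (\<open>family_triangle_homothetic_aliquot\<close>).

  A triangle center is carried along by homotheties: homogeneity of \<open>\<psi>\<close> multiplies
  all three barycentric weights by one positive factor (\<open>triangle_center_homothety\<close>). So the
  curve of \<open>\<Psi>\<close> at \<open>t\<close>, seen from the centroid, is \<open>s\<close> times the aliquot curve at \<open>\<tau>\<close>, and the
  functions \<open>t \<mapsto> s * l \<tau>\<close> with the vectors of the aliquot family witness semi-invariance. At
  parameters where the triangle collapses to the centroid they are set to zero.\<close>

section \<open>Nondegeneracy of aliquot triangles\<close>

text \<open>A determinant criterion turns nondegeneracy into a polynomial identity in the
  coordinates.\<close>

lemma collinear_iff_cross_eq_0:
  fixes A B C :: "real^2"
  shows "collinear {A, B, C} \<longleftrightarrow>
    (B$1 - A$1) * (C$2 - A$2) - (B$2 - A$2) * (C$1 - A$1) = 0"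
proof -
  have parallel: "collinear {0, x, y} \<longleftrightarrow> x$1 * y$2 - x$2 * y$1 = 0" for x y :: "real^2"
  proof
    assume "collinear {0, x, y}"
    then show "x$1 * y$2 - x$2 * y$1 = 0"
      by (auto simp: collinear_lemma)
  next
    assume cross: "x$1 * y$2 - x$2 * y$1 = 0"
    show "collinear {0, x, y}"
    proof (cases "x = 0")
      case False
      (* The scalar is read off from a nonzero coordinate of x. *)
      then consider "x$1 \<noteq> 0" | "x$2 \<noteq> 0"
        by (auto simp: vec_eq_iff forall_2)
      then have "\<exists>c. y = c *\<^sub>R x"
      proof cases
        case 1
        then have "y = (y$1 / x$1) *\<^sub>R x"
          using cross by (simp add: vec_eq_iff forall_2 field_simps)
        then show ?thesis ..
      next
        case 2
        then have "y = (y$2 / x$2) *\<^sub>R x"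
          using cross by (simp add: vec_eq_iff forall_2 field_simps)
        then show ?thesis ..
      qed
      then show ?thesis
        by (simp add: collinear_lemma)
    qed simp
  qed
  have "collinear {A, B, C} \<longleftrightarrow> collinear {B, A, C}"
    by (simp add: insert_commute)
  also have "\<dots> \<longleftrightarrow> collinear {0, B - A, C - A}"
    by (rule collinear_3) (simp add: NO_MATCH_def)
  finally show ?thesis
    by (simp add: parallel)
qed

text \<open>The map from a triangle to its aliquot triangle multiplies the signed area by
  \<open>1 - 3 t + 3 t\<^sup>2\<close>, which has negative discriminant.\<close>

lemma nondegenerate_aliquot:
  assumes "nondegenerate (A, B, C)"
  shows "nondegenerate (family_triangle aliquot_family (A, B, C) t)"
proof -
  have "0 < 3 * (t - 1/2)\<^sup>2 + (1/4 :: real)"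
    by (intro add_nonneg_pos) auto
  then have "1 - 3 * t + 3 * t\<^sup>2 \<noteq> 0"
    by (simp add: power2_eq_square algebra_simps)
  moreover have "family_triangle aliquot_family (A, B, C) t =
      ((1 - t) *\<^sub>R B + t *\<^sub>R C, t *\<^sub>R A + (1 - t) *\<^sub>R C, (1 - t) *\<^sub>R A + t *\<^sub>R B)"
    by (simp add: family_triangle_def aliquot_family_def)
  moreover have
    "((t * A$1 + (1-t) * C$1) - ((1-t) * B$1 + t * C$1)) * (((1-t) * A$2 + t * B$2) - ((1-t) * B$2 + t * C$2))
     - ((t * A$2 + (1-t) * C$2) - ((1-t) * B$2 + t * C$2)) * (((1-t) * A$1 + t * B$1) - ((1-t) * B$1 + t * C$1))
     = (1 - 3 * t + 3 * t\<^sup>2) * ((B$1 - A$1) * (C$2 - A$2) - (B$2 - A$2) * (C$1 - A$1))"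
    by algebra
  ultimately show ?thesis
    using assms by (simp add: collinear_iff_cross_eq_0)
qed

section \<open>Triangle centers and homotheties\<close>

definition homothety :: "point \<Rightarrow> real \<Rightarrow> point \<Rightarrow> point" where
  "homothety G s x = G + s *\<^sub>R (x - G)"

fun map_triangle :: "(point \<Rightarrow> point) \<Rightarrow> triangle \<Rightarrow> triangle" where
  "map_triangle f (A, B, C) = (f A, f B, f C)"

lemma dist_homothety: "dist (homothety G s x) (homothety G s y) = \<bar>s\<bar> * dist x y"
proof -
  have "homothety G s x - homothety G s y = s *\<^sub>R (x - y)"
    by (simp add: homothety_def algebra_simps)
  then show ?thesis
    by (simp add: dist_norm)
qed

lemma side_triples_rotate:
  assumes "nondegenerate (A, B, C)"
  shows "(dist B C, dist C A, dist A B) \<in> side_triples"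
    and "(dist C A, dist A B, dist B C) \<in> side_triples"
    and "(dist A B, dist B C, dist C A) \<in> side_triples"
proof -
  have "nondegenerate (B, C, A)" "nondegenerate (C, A, B)"
    using assms by (simp_all add: insert_commute)
  then have "side_lengths (A, B, C) \<in> side_triples" "side_lengths (B, C, A) \<in> side_triples"
      "side_lengths (C, A, B) \<in> side_triples"
    using assms unfolding side_triples_def by blast+
  then show "(dist B C, dist C A, dist A B) \<in> side_triples"
      "(dist C A, dist A B, dist B C) \<in> side_triples"
      "(dist A B, dist B C, dist C A) \<in> side_triples"
    by simp_all
qed

text \<open>The ratio may be negative, since side lengths only see its absolute value. The factor is
  \<open>\<bar>s\<bar> * \<bar>s\<bar> powr d\<close> for \<open>\<psi>\<close> homogeneous of degree \<open>d\<close>.\<close>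

lemma center_weights_homothety:
  assumes "triangle_center_function \<psi>" "nondegenerate \<Delta>" "s \<noteq> 0"
    and "center_weights \<psi> \<Delta> = (u, v, w)"
  obtains k where "k \<noteq> 0"
    "center_weights \<psi> (map_triangle (homothety G s) \<Delta>) = (k * u, k * v, k * w)"
proof -
  obtain A B C where \<Delta>: "\<Delta> = (A, B, C)"
    by (cases \<Delta>)
  obtain d where hom: "\<And>a b c s. (a, b, c) \<in> side_triples \<Longrightarrow> s > 0 \<Longrightarrow>
      \<psi> (s * a) (s * b) (s * c) = s powr d * \<psi> a b c"
    using assms(1) unfolding triangle_center_function_def by blast
  have "\<bar>s\<bar> > 0"
    using assms(3) by simp
  note scale = side_triples_rotate[OF assms(2)[unfolded \<Delta>], THEN hom, OF this]
  show ?thesis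
  proof
    show "\<bar>s\<bar> * \<bar>s\<bar> powr d \<noteq> 0"
      using assms(3) by simp
    show "center_weights \<psi> (map_triangle (homothety G s) \<Delta>) =
        ((\<bar>s\<bar> * \<bar>s\<bar> powr d) * u, (\<bar>s\<bar> * \<bar>s\<bar> powr d) * v, (\<bar>s\<bar> * \<bar>s\<bar> powr d) * w)"
      using assms(4) by (auto simp: \<Delta> center_weights_def dist_homothety scale)
  qed
qed

lemma center_defined_homothety:
  assumes "triangle_center_function \<psi>" "nondegenerate \<Delta>" "s \<noteq> 0"
  shows "center_defined \<psi> (map_triangle (homothety G s) \<Delta>) \<longleftrightarrow> center_defined \<psi> \<Delta>"
proof -
  obtain u v w where uvw: "center_weights \<psi> \<Delta> = (u, v, w)"
    by (cases "center_weights \<psi> \<Delta>")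
  obtain k where k: "k \<noteq> 0"
      "center_weights \<psi> (map_triangle (homothety G s) \<Delta>) = (k * u, k * v, k * w)"
    using center_weights_homothety[OF assms uvw] .
  then have "k * u + k * v + k * w = k * (u + v + w)"
    by (simp add: algebra_simps)
  with uvw k show ?thesis
    by (simp add: center_defined_def)
qed

lemma bary_homothety:
  assumes "u + v + w \<noteq> 0"
  shows "bary (u, v, w) (map_triangle (homothety G s) \<Delta>) = homothety G s (bary (u, v, w) \<Delta>)"
proof -
  obtain A B C where \<Delta>: "\<Delta> = (A, B, C)"
    by (cases \<Delta>)
  have "u *\<^sub>R homothety G s A + v *\<^sub>R homothety G s B + w *\<^sub>R homothety G s C
      = (u + v + w) *\<^sub>R (G - s *\<^sub>R G) + s *\<^sub>R (u *\<^sub>R A + v *\<^sub>R B + w *\<^sub>R C)"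
    by (simp add: homothety_def algebra_simps)
  then show ?thesis
    using assms by (simp add: \<Delta> homothety_def scaleR_add_right[of "1 / (u + v + w)"])
      (simp add: algebra_simps)
qed

lemma bary_scale_weights:
  assumes "k \<noteq> 0"
  shows "bary (k * u, k * v, k * w) \<Delta> = bary (u, v, w) \<Delta>"
proof -
  obtain A B C where \<Delta>: "\<Delta> = (A, B, C)"
    by (cases \<Delta>)
  have "1 / (k * u + k * v + k * w) * k = 1 / (u + v + w)"
    using assms by (simp flip: distrib_left)
  moreover have "(k * u) *\<^sub>R A + (k * v) *\<^sub>R B + (k * w) *\<^sub>R C
      = k *\<^sub>R (u *\<^sub>R A + v *\<^sub>R B + w *\<^sub>R C)"
    by (simp add: scaleR_add_right)
  ultimately show ?thesis
    by (simp only: \<Delta> bary.simps scaleR_scaleR)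
qed

lemma triangle_center_homothety:
  assumes "triangle_center_function \<psi>" "nondegenerate \<Delta>" "s \<noteq> 0" "center_defined \<psi> \<Delta>"
  shows "triangle_center \<psi> (map_triangle (homothety G s) \<Delta>) =
    homothety G s (triangle_center \<psi> \<Delta>)"
proof -
  obtain u v w where uvw: "center_weights \<psi> \<Delta> = (u, v, w)"
    by (cases "center_weights \<psi> \<Delta>")
  obtain k where k: "k \<noteq> 0"
      "center_weights \<psi> (map_triangle (homothety G s) \<Delta>) = (k * u, k * v, k * w)"
    using center_weights_homothety[OF assms(1-3) uvw] .
  have "u + v + w \<noteq> 0"
    using assms(4) uvw by (simp add: center_defined_def)
  then show ?thesis
    by (simp add: triangle_center_def uvw k bary_scale_weights bary_homothety)
qed

section \<open>Reduction of decomposable families to the aliquot family\<close>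

definition aliquot_ratio :: "real^3 \<Rightarrow> real" where
  "aliquot_ratio p = (p$2 + p$3 - 2 * p$1) / (p$1 + p$2 + p$3)"

definition aliquot_parameter :: "real^3 \<Rightarrow> real" where
  "aliquot_parameter p = (p$3 - p$1) / (p$2 + p$3 - 2 * p$1)"

text \<open>One vertex suffices, for arbitrary weights and vertices: the other two vertices arise by
  permuting the points cyclically.\<close>

lemma bary_homothetic_aliquot:
  assumes S: "p + q + r \<noteq> 0" and D: "q + r - 2 * p \<noteq> 0"
  shows "bary (p, q, r) (A, B, C) = homothety (centroid (A, B, C)) ((q + r - 2 * p) / (p + q + r))
    (bary (0, 1 - (r - p) / (q + r - 2 * p), (r - p) / (q + r - 2 * p)) (A, B, C))"
proof -
  define s where "s = (q + r - 2 * p) / (p + q + r)"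
  define \<tau> where "\<tau> = (r - p) / (q + r - 2 * p)"
  have s\<tau>: "s * \<tau> = (r - p) / (p + q + r)"
    using D by (simp add: s_def \<tau>_def)
  have s3: "(1 - s) / 3 = p / (p + q + r)"
    using S by (simp add: s_def field_simps)
  have coeffs: "p / (p + q + r) = (1 - s) / 3"
      "q / (p + q + r) = (1 - s) / 3 + s - s * \<tau>" "r / (p + q + r) = (1 - s) / 3 + s * \<tau>"
    unfolding s\<tau> s3 by (simp_all add: s_def add_divide_distrib diff_divide_distrib)
  have "bary (p, q, r) (A, B, C) = (p / (p + q + r)) *\<^sub>R A + (q / (p + q + r)) *\<^sub>R B
      + (r / (p + q + r)) *\<^sub>R C"
    by (simp add: scaleR_add_right)
  also have "\<dots> = homothety (centroid (A, B, C)) s (bary (0, 1 - \<tau>, \<tau>) (A, B, C))"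
    unfolding coeffs by (simp add: homothety_def vec_eq_iff field_simps)
  finally show ?thesis
    by (simp add: s_def \<tau>_def)
qed

lemma family_triangle_homothetic_aliquot:
  assumes S: "\<Psi> t $ 1 + \<Psi> t $ 2 + \<Psi> t $ 3 \<noteq> 0"
    and D: "2 * \<Psi> t $ 1 - \<Psi> t $ 2 - \<Psi> t $ 3 \<noteq> 0"
  shows "family_triangle \<Psi> \<Delta> t =
    map_triangle (homothety (centroid \<Delta>) (aliquot_ratio (\<Psi> t)))
      (family_triangle aliquot_family \<Delta> (aliquot_parameter (\<Psi> t)))"
proof -
  obtain A B C where \<Delta>: "\<Delta> = (A, B, C)"
    by (cases \<Delta>)
  let ?p = "\<Psi> t $ 1" and ?q = "\<Psi> t $ 2" and ?r = "\<Psi> t $ 3"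
  have D': "?q + ?r - 2 * ?p \<noteq> 0"
    using D by simp
  have rotate: "bary (p, q, r) (B, C, A) = bary (r, p, q) (A, B, C)"
      "bary (p, q, r) (C, A, B) = bary (q, r, p) (A, B, C)" for p q r
    by (simp_all add: add_ac)
  have "centroid (B, C, A) = centroid (A, B, C)" "centroid (C, A, B) = centroid (A, B, C)"
    by (simp_all add: add_ac)
  note vertices = bary_homothetic_aliquot[OF S D', of A B C]
    bary_homothetic_aliquot[OF S D', of B C A, unfolded this rotate]
    bary_homothetic_aliquot[OF S D', of C A B, unfolded this rotate]
  have "aliquot_family \<tau> $ 1 = 0" "aliquot_family \<tau> $ 2 = 1 - \<tau>" "aliquot_family \<tau> $ 3 = \<tau>" for \<tau>
    by (simp_all add: aliquot_family_def)
  then show ?thesis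
    by (simp only: \<Delta> family_triangle_def map_triangle.simps aliquot_ratio_def
        aliquot_parameter_def vertices)
qed

theorem semi_invariant_decomposable:
  assumes \<psi>: "triangle_center_function \<psi>" and ali: "semi_invariant \<psi> aliquot_family"
    and fam: "triangle_family \<Psi>" and dec: "decomposable \<Psi>"
  shows "semi_invariant \<psi> \<Psi>"
proof -
  obtain lx ly :: "real \<Rightarrow> real" where l: "\<And>\<Delta>. nondegenerate \<Delta> \<Longrightarrow> \<not> equilateral \<Delta> \<Longrightarrow>
      \<exists>Vx Vy. \<forall>t. curve_defined \<psi> aliquot_family \<Delta> t \<longrightarrow>
        curve \<psi> aliquot_family \<Delta> t = centroid \<Delta> + lx t *\<^sub>R Vx + ly t *\<^sub>R Vy"
    using ali unfolding semi_invariant_def by blast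
  define pullback where "pullback f t = (if \<Psi> t $ 1 = \<Psi> t $ 2 \<and> \<Psi> t $ 2 = \<Psi> t $ 3 then 0
      else aliquot_ratio (\<Psi> t) * f (aliquot_parameter (\<Psi> t)))" for f :: "real \<Rightarrow> real" and t
  have "\<exists>Vx Vy. \<forall>t. curve_defined \<psi> \<Psi> \<Delta> t \<longrightarrow>
      curve \<psi> \<Psi> \<Delta> t = centroid \<Delta> + pullback lx t *\<^sub>R Vx + pullback ly t *\<^sub>R Vy"
    if nondeg: "nondegenerate \<Delta>" and "\<not> equilateral \<Delta>" for \<Delta>
  proof -
    obtain Vx Vy where V: "\<And>t. curve_defined \<psi> aliquot_family \<Delta> t \<Longrightarrow>
        curve \<psi> aliquot_family \<Delta> t = centroid \<Delta> + lx t *\<^sub>R Vx + ly t *\<^sub>R Vy"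
      using l[OF \<open>nondegenerate \<Delta>\<close> \<open>\<not> equilateral \<Delta>\<close>] by blast
    have "curve \<psi> \<Psi> \<Delta> t = centroid \<Delta> + pullback lx t *\<^sub>R Vx + pullback ly t *\<^sub>R Vy"
      if def: "curve_defined \<psi> \<Psi> \<Delta> t" for t
    proof (cases "\<Psi> t $ 1 = \<Psi> t $ 2 \<and> \<Psi> t $ 2 = \<Psi> t $ 3")
      case True
      then show ?thesis
        by (simp add: curve_def pullback_def)
    next
      case False
      define s \<tau> where "s = aliquot_ratio (\<Psi> t)" and "\<tau> = aliquot_parameter (\<Psi> t)"
      define T where "T = family_triangle aliquot_family \<Delta> \<tau>"
      have S: "\<Psi> t $ 1 + \<Psi> t $ 2 + \<Psi> t $ 3 \<noteq> 0"
        using fam by (simp add: triangle_family_def)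
      have D: "2 * \<Psi> t $ 1 - \<Psi> t $ 2 - \<Psi> t $ 3 \<noteq> 0"
        using dec False unfolding decomposable_def by blast
      have s: "s \<noteq> 0"
        using S D by (simp add: s_def aliquot_ratio_def)
      have tri: "family_triangle \<Psi> \<Delta> t = map_triangle (homothety (centroid \<Delta>) s) T"
        unfolding s_def \<tau>_def T_def by (rule family_triangle_homothetic_aliquot[where \<Psi> = \<Psi> and t = t, OF S D])
      have T: "nondegenerate T"
        using nondeg by (cases \<Delta>) (simp only: T_def nondegenerate_aliquot)
      have T_def': "center_defined \<psi> T"
        using def False unfolding curve_defined_def tri center_defined_homothety[OF \<psi> T s] by blast
      (* 0, 1 - \<tau> and \<tau> are never all equal, so no aliquot triangle collapses. *)
      have "\<not> (aliquot_family \<tau> $ 1 = aliquot_family \<tau> $ 2 \<and> aliquot_family \<tau> $ 2 = aliquot_family \<tau> $ 3)"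
        by (auto simp: aliquot_family_def)
      then have "triangle_center \<psi> T = curve \<psi> aliquot_family \<Delta> \<tau>"
        by (simp only: curve_def T_def if_False)
      also have "\<dots> = centroid \<Delta> + lx \<tau> *\<^sub>R Vx + ly \<tau> *\<^sub>R Vy"
        using T_def' by (intro V) (simp add: curve_defined_def T_def)
      finally have "curve \<psi> \<Psi> \<Delta> t = homothety (centroid \<Delta>) s (centroid \<Delta> + lx \<tau> *\<^sub>R Vx + ly \<tau> *\<^sub>R Vy)"
        using False by (simp only: curve_def tri triangle_center_homothety[OF \<psi> T s T_def'] if_False)
      moreover have "pullback f t = s * f \<tau>" for f
        using False by (simp only: pullback_def s_def \<tau>_def if_False)
      ultimately show ?thesis
        by (simp add: homothety_def algebra_simps)
    qed
    then show ?thesis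
      by blast
  qed
  then show ?thesis
    unfolding semi_invariant_def by blast
qed

section \<open>The nedian family\<close>

lemma triangle_family_nedian: "triangle_family nedian_family"
proof -
  have "(1 - t) * t + t\<^sup>2 + (1 - t)\<^sup>2 \<noteq> 0" for t :: real
  proof -
    have "(1 - t) * t + t\<^sup>2 + (1 - t)\<^sup>2 = (t - 1/2)\<^sup>2 + 3/4"
      by (simp add: power2_eq_square algebra_simps)
    also have "\<dots> > 0"
      by (intro add_nonneg_pos) auto
    finally show ?thesis
      by simp
  qed
  moreover have "nedian_family 0 $ 2 \<noteq> nedian_family 0 $ 3"
    by (simp add: nedian_family_def)
  ultimately show ?thesis
    unfolding triangle_family_def by (metis nedian_family_def vector_3)
qed

text \<open>The decomposability condition is \<open>- (2 t - 1)\<^sup>2 = 0\<close>, so it only concerns \<open>t = 1/2\<close>,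
  where all three coordinates equal \<open>1/4\<close>.\<close>

lemma decomposable_nedian: "decomposable nedian_family"
proof -
  have half: "t = 1/2" if "2 * ((1 - t) * t) - t\<^sup>2 - (1 - t)\<^sup>2 = 0" for t :: real
  proof -
    have "(2 * t - 1)\<^sup>2 = 0"
      using that by (simp add: power2_eq_square algebra_simps)
    then show ?thesis
      by simp
  qed
  show ?thesis
    unfolding decomposable_def
  proof (intro allI impI)
    fix t
    assume "2 * nedian_family t $ 1 - nedian_family t $ 2 - nedian_family t $ 3 = 0"
    then have "t = 1/2"
      by (intro half) (simp add: nedian_family_def)
    show "nedian_family t $ 1 = nedian_family t $ 2 \<and> nedian_family t $ 2 = nedian_family t $ 3"
      unfolding \<open>t = 1/2\<close> by (simp add: nedian_family_def power2_eq_square)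
  qed
qed

section \<open>Semi-invariance for all decomposable families\<close>

theorem corollary2:
  fixes \<psi> :: "real \<Rightarrow> real \<Rightarrow> real \<Rightarrow> real"
  assumes "triangle_center_function \<psi>"
    and "semi_invariant \<psi> aliquot_family"
  shows "(\<forall>\<Psi>. triangle_family \<Psi> \<and> decomposable \<Psi> \<longrightarrow> semi_invariant \<psi> \<Psi>) \<and>
    (triangle_family nedian_family \<and> decomposable nedian_family \<and> semi_invariant \<psi> nedian_family)"
  using semi_invariant_decomposable[OF assms] triangle_family_nedian decomposable_nedian by blast

end
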